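(* Let $n\ge0$ and $k\ge1$ be integers with $\binom{n}{\lfloor n/2\rfloor}=k$, and let $\varphi_1=\neg p\vee\neg\neg p$ and, for $k>1$, $\varphi_k=\bigvee_{1\le i,j\le k,\ i\neq j}(\neg p_i\rightarrow\neg p_j)\vee\neg(\neg p_1\wedge\cdots\wedge\neg p_k)$. Then: (i) if $L\in\mathfrak{B}_m$ with $m\le n$, then $L$ satisfies $\varphi_k$; (ii) if $L\in\mathfrak{B}_m^\bot$ with $m>n$, then $L$ does not satisfy $\varphi_k$.
   Context: A Brouwer algebra is a bounded distributive lattice $\langle L,+,\times,0,1\rangle$ ($+$ = join, $\times$ = meet) with a binary operation $\rightarrow$ satisfying $b\le a+c\iff a\rightarrow b\le c$, and $\neg a=a\rightarrow1$. $L$ satisfies a propositional formula if every substitution of elements of $L$ for its variables, interpreting $\vee,\wedge,\rightarrow,\neg$ as $\times,+,\rightarrow,\neg$ respectively, yields $0$. $\mathfrak{B}_m$ is the class of Brouwer algebras (not necessarily finite) whose top element is the join of some antichain of $m$ join-irreducible elements; $\mathfrak{B}_m^\bot$ is the subclass of $\mathfrak{B}_m$ consisting of algebras whose least element $0$ is meet-irreducible.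
   Formalization: Part (ii) excludes the case n=0, m=1 (so k=1), where the claim is false: every algebra in B_1, for example the two-element chain in B_1^⊥, satisfies ¬p∨¬¬p. *)

theory Defs
  imports Main "HOL-Library.Lub_Glb"
begin

text \<open>
  The lattice operations \<open>+\<close>, \<open>\<times>\<close>, \<open>0\<close>, \<open>1\<close> are \<^const>\<open>sup\<close>, \<^const>\<open>inf\<close>, \<^const>\<open>bot\<close>, \<^const>\<open>top\<close>.
  The one-element algebra, where \<open>bot = top\<close>, is not excluded.
\<close>

class brouwer_algebra = distrib_lattice + bounded_lattice +
  fixes brouwer_imp :: "'a \<Rightarrow> 'a \<Rightarrow> 'a"  (infixr \<open>\<rightarrow>\<^sub>B\<close> 60)
  assumes brouwer_adjoint: "b \<le> sup a c \<longleftrightarrow> a \<rightarrow>\<^sub>B b \<le> c"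

definition brouwer_neg :: "'a::brouwer_algebra \<Rightarrow> 'a"  (\<open>\<not>\<^sub>B _\<close> [81] 80)
  where "\<not>\<^sub>B a = a \<rightarrow>\<^sub>B top"

datatype form =
    Var nat
  | Disj form form
  | Conj form form
  | Imp form form
  | Neg form

text \<open>Brouwer algebras are dual to Heyting algebras: disjunction is meet, conjunction is join,
  and truth is the least element.\<close>

primrec form_eval :: "(nat \<Rightarrow> 'a::brouwer_algebra) \<Rightarrow> form \<Rightarrow> 'a" where
  "form_eval v (Var i) = v i"
| "form_eval v (Disj A B) = inf (form_eval v A) (form_eval v B)"
| "form_eval v (Conj A B) = sup (form_eval v A) (form_eval v B)"
| "form_eval v (Imp A B) = form_eval v A \<rightarrow>\<^sub>B form_eval v B"
| "form_eval v (Neg A) = \<not>\<^sub>B form_eval v A"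

text \<open>An algebra \<open>L\<close> is a type of class \<^class>\<open>brouwer_algebra\<close>, passed as \<open>TYPE('a)\<close>.\<close>

definition satisfies :: "'a::brouwer_algebra itself \<Rightarrow> form \<Rightarrow> bool"
  where "satisfies L A \<longleftrightarrow> (\<forall>v :: nat \<Rightarrow> 'a. form_eval v A = bot)"

definition join_irreducible :: "'a::bounded_lattice \<Rightarrow> bool"
  where "join_irreducible a \<longleftrightarrow> a \<noteq> bot \<and> (\<forall>b c. a = sup b c \<longrightarrow> a = b \<or> a = c)"

definition meet_irreducible :: "'a::bounded_lattice \<Rightarrow> bool"
  where "meet_irreducible a \<longleftrightarrow> a \<noteq> top \<and> (\<forall>b c. a = inf b c \<longrightarrow> a = b \<or> a = c)"

definition antichain :: "'a::order set \<Rightarrow> bool"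
  where "antichain A \<longleftrightarrow> (\<forall>x\<in>A. \<forall>y\<in>A. x \<le> y \<longrightarrow> x = y)"

definition class_B :: "nat \<Rightarrow> 'a::brouwer_algebra itself \<Rightarrow> bool"
  where "class_B m L \<longleftrightarrow>
    (\<exists>A :: 'a set. finite A \<and> card A = m \<and> antichain A \<and>
       (\<forall>a\<in>A. join_irreducible a) \<and> isLub UNIV A top)"

definition class_B_bot :: "nat \<Rightarrow> 'a::brouwer_algebra itself \<Rightarrow> bool"
  where "class_B_bot m L \<longleftrightarrow> class_B m L \<and> meet_irreducible (bot :: 'a)"

text \<open>The folds end in the last disjunct (resp. conjunct), so no empty disjunction or conjunction
  is needed. The value at \<open>k = 0\<close> is irrelevant.\<close>

definition phi :: "nat \<Rightarrow> form" where
  "phi k =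
    (if k = 1 then Disj (Neg (Var 1)) (Neg (Neg (Var 1)))
     else foldr Disj
       [Imp (Neg (Var i)) (Neg (Var j)). i \<leftarrow> [1..<k+1], j \<leftarrow> [1..<k+1], i \<noteq> j]
       (Neg (foldr Conj [Neg (Var i). i \<leftarrow> [1..<k]] (Neg (Var k)))))"

end

theory Submission
  imports Defs Complex_Main
begin

text \<open>
  In a distributive lattice join-irreducible elements are join-prime. So if \<open>A\<close> is the antichain of
  join-irreducibles with join \<open>top\<close>, then \<open>\<not>\<^sub>B p\<close> is the join of \<open>S p = {a \<in> A. \<not> a \<le> p}\<close>, every
  subset of \<open>A\<close> is of the form \<open>S p\<close>, and \<open>\<not>\<^sub>B q \<le> \<not>\<^sub>B p\<close> holds iff \<open>S q \<subseteq> S p\<close>.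
  For \<open>k > 1\<close>, the disjuncts of \<open>\<phi>\<^sub>k\<close> can therefore all be nonzero iff some proper subset
  of \<open>A\<close> carries an antichain of \<open>k\<close> sets; by Sperner's theorem, and because central binomial
  coefficients grow strictly, this happens iff \<open>card A > n\<close>.
  Meet-irreducibility of \<open>bot\<close> makes the meet of nonzero disjuncts nonzero.
\<close>

section \<open>Sperner's theorem\<close>

text \<open>Pascal's rule adds \<open>n choose Suc (n div 2)\<close>, which is positive because
  \<open>Suc (n div 2) \<le> n\<close> for \<open>n \<ge> 1\<close>.\<close>

lemma central_binomial_less_Suc:
  assumes "n \<ge> 1"
  shows "n choose (n div 2) < Suc n choose (Suc n div 2)"
proof -
  have "n choose Suc (n div 2) > 0"
    using assms by (simp add: zero_less_binomial_iff)
  then have "n choose (n div 2) < Suc n choose Suc (n div 2)"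
    by simp
  also have "\<dots> \<le> Suc n choose (Suc n div 2)"
    by (rule binomial_maximum)
  finally show ?thesis .
qed

text \<open>Given \<open>m < n\<close>, the bound \<open>n \<ge> 2\<close> excludes just the pair 0,
  1, where both coefficients are 1.\<close>

lemma central_binomial_strict_mono:
  assumes "m < n" "n \<ge> 2"
  shows "m choose (m div 2) < n choose (n div 2)"
proof -
  have *: "m choose (m div 2) < n choose (n div 2)" if "1 \<le> m" "m < n" for m
    using that(2)
  proof (induction n)
    case (Suc n)
    then show ?case
      using central_binomial_less_Suc[of n] that(1) by (fastforce simp: less_Suc_eq)
  qed simp
  show ?thesis
    using *[of m] *[of 1] assms by (cases "m = 0") auto
qed

text \<open>Induction on the ground set: for \<open>X \<notin> F\<close>, sum the inequality for the members of \<open>F\<close> that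
  avoid \<open>x\<close> over all \<open>x \<in> X\<close>, and use \<open>(n - a) (n choose a) = n (n - 1 choose a)\<close>.\<close>

lemma lym_inequality:
  fixes F :: "'a set set"
  assumes "finite X" "F \<subseteq> Pow X" "antichain F"
  shows "(\<Sum>S\<in>F. 1 / real (card X choose card S)) \<le> 1"
  using assms
proof (induction "card X" arbitrary: X F)
  case 0
  then have "X = {}" by simp
  then have "F = {} \<or> F = {{}}"
    using 0(3) by (simp add: subset_singleton_iff)
  then show ?case by auto
next
  case (Suc n)
  have finF: "finite F"
    using Suc.prems finite_subset by blast
  show ?case
  \<comment> \<open>\<open>S = X\<close> needs its own case: the absorption identity divides by
    \<open>n choose card S\<close>, which is 0 there.\<close>
  proof (cases "X \<in> F")
    case True
    then have "F = {X}"
      using Suc.prems(2,3) unfolding antichain_def by blast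
    then show ?thesis by simp
  next
    case False
    have IH: "(\<Sum>S | S \<in> F \<and> x \<notin> S. 1 / real (n choose card S)) \<le> 1" if "x \<in> X" for x
    proof -
      have "n = card (X - {x})" using Suc.hyps(2) Suc.prems(1) that by simp
      moreover have "{S \<in> F. x \<notin> S} \<subseteq> Pow (X - {x})" using Suc.prems(2) by auto
      moreover have "antichain {S \<in> F. x \<notin> S}"
        using Suc.prems(3) by (simp add: antichain_def)
      ultimately show ?thesis
        using Suc.hyps(1)[of "X - {x}" "{S \<in> F. x \<notin> S}"] Suc.prems(1) by simp
    qed
    have term_eq: "real (card (X - S)) / real (n choose card S)
        = real (Suc n) * (1 / real (card X choose card S))" if "S \<in> F" for S
    proof -
      have "S \<subset> X" using that False Suc.prems(2) by auto
      then have lt: "card S < Suc n" and c: "card (X - S) = Suc n - card S"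
        using Suc.prems(1) Suc.hyps(2)
        by (simp_all add: psubset_card_mono card_Diff_subset finite_subset[of S X])
      have "(Suc n - card S) * (Suc n choose card S) = Suc n * (n choose card S)"
        using binomial_absorb_comp[of "Suc n" "card S"] by simp
      then have "real (Suc n - card S) * real (Suc n choose card S)
          = real (Suc n) * real (n choose card S)"
        by (metis of_nat_mult)
      moreover have "n choose card S > 0" "Suc n choose card S > 0"
        using lt by (simp_all add: zero_less_binomial_iff del: binomial_Suc_Suc)
      ultimately show ?thesis
        unfolding c Suc.hyps(2)[symmetric] by (simp add: field_simps del: binomial_Suc_Suc of_nat_Suc)
    qed
    have "real (Suc n) * (\<Sum>S\<in>F. 1 / real (card X choose card S))
        = (\<Sum>S\<in>F. real (card (X - S)) / real (n choose card S))"
      by (simp only: sum_distrib_left term_eq cong: sum.cong)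
    also have "\<dots> = (\<Sum>S\<in>F. \<Sum>x | x \<in> X \<and> x \<notin> S. 1 / real (n choose card S))"
      by (simp add: set_diff_eq)
    also have "\<dots> = (\<Sum>x\<in>X. \<Sum>S | S \<in> F \<and> x \<notin> S. 1 / real (n choose card S))"
      by (rule sum.swap_restrict[OF finF Suc.prems(1)])
    also have "\<dots> \<le> (\<Sum>x\<in>X. 1)"
      by (rule sum_mono) (rule IH)
    also have "\<dots> = real (Suc n) * 1"
      using Suc.hyps(2) by simp
    finally show ?thesis
      by (rule mult_left_le_imp_le) simp
  qed
qed

text \<open>The central coefficient is the largest, so every term of the LYM sum is at least its
  reciprocal.\<close>

theorem sperner:
  fixes F :: "'a set set"
  assumes "finite X" "F \<subseteq> Pow X" "antichain F"
  shows "card F \<le> card X choose (card X div 2)"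
proof -
  let ?c = "card X choose (card X div 2)"
  have pos: "real ?c > 0" by (simp add: zero_less_binomial_iff)
  have "real (card F) / real ?c = (\<Sum>S\<in>F. 1 / real ?c)"
    by simp
  also have "\<dots> \<le> (\<Sum>S\<in>F. 1 / real (card X choose card S))"
  proof (rule sum_mono)
    fix S assume "S \<in> F"
    then have "card X choose card S > 0"
      using assms by (auto simp: zero_less_binomial_iff intro: card_mono)
    then show "1 / real ?c \<le> 1 / real (card X choose card S)"
      by (intro divide_left_mono) (auto simp: binomial_maximum)
  qed
  also have "\<dots> \<le> 1"
    using assms by (rule lym_inequality)
  finally show ?thesis
    using pos by (simp add: divide_le_eq)
qed

section \<open>Negation in terms of join-irreducibles\<close>

text \<open>Distributivity splits such an \<open>a\<close> into the join of \<open>inf a b\<close>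
  and \<open>inf a c\<close>, and irreducibility makes it one of these.\<close>

lemma join_irreducible_le_sup_iff:
  fixes a :: "'a::{distrib_lattice, bounded_lattice}"
  assumes "join_irreducible a"
  shows "a \<le> sup b c \<longleftrightarrow> a \<le> b \<or> a \<le> c"
proof
  assume "a \<le> sup b c"
  then have "a = sup (inf a b) (inf a c)"
    by (simp add: inf_absorb1 flip: inf_sup_distrib1)
  then have "a = inf a b \<or> a = inf a c"
    using assms unfolding join_irreducible_def by blast
  then show "a \<le> b \<or> a \<le> c"
    by (metis inf.cobounded2)
qed (auto intro: le_supI1 le_supI2)

text \<open>Inserting \<open>bot\<close> accounts for the empty join.\<close>

definition fin_join :: "'a::bounded_lattice set \<Rightarrow> 'a"
  where "fin_join S = Sup_fin (insert bot S)"

lemma fin_join_le_iff: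
  "finite S \<Longrightarrow> fin_join S \<le> c \<longleftrightarrow> (\<forall>s\<in>S. s \<le> c)"
  by (simp add: fin_join_def Sup_fin.bounded_iff)

text \<open>Binary join-primeness extends by induction; the empty join is \<open>bot\<close>, which
  bounds no join-irreducible since these are nonzero.\<close>

lemma join_irreducible_le_fin_join_iff:
  fixes a :: "'a::{distrib_lattice, bounded_lattice}"
  assumes "join_irreducible a" "finite S"
  shows "a \<le> fin_join S \<longleftrightarrow> (\<exists>s\<in>S. a \<le> s)"
  using assms(2)
proof (induction S)
  case empty
  then show ?case
    using assms(1) by (auto simp: fin_join_def join_irreducible_def bot_unique)
next
  case (insert x S)
  have "fin_join (insert x S) = sup x (fin_join S)"
    using insert(1) by (simp add: fin_join_def insert_commute[of bot x])
  then show ?case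
    using insert.IH by (simp add: join_irreducible_le_sup_iff[OF assms(1)])
qed

lemma brouwer_imp_eq_bot_iff:
  fixes a b :: "'a::brouwer_algebra"
  shows "a \<rightarrow>\<^sub>B b = bot \<longleftrightarrow> b \<le> a"
  using brouwer_adjoint[of b a bot] by (simp add: bot_unique)

lemma brouwer_neg_eq_bot_iff:
  fixes a :: "'a::brouwer_algebra"
  shows "\<not>\<^sub>B a = bot \<longleftrightarrow> a = top"
  by (simp add: brouwer_neg_def brouwer_imp_eq_bot_iff top_unique)

locale join_irreducible_antichain =
  fixes A :: "'a::brouwer_algebra set"
  assumes finite: "finite A"
    and antichain: "antichain A"
    and irreducible: "a \<in> A \<Longrightarrow> join_irreducible a"
    and isLub_top: "isLub UNIV A top"
begin

lemma eq_top_iff: "c = top \<longleftrightarrow> (\<forall>a\<in>A. a \<le> c)"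
proof
  assume "\<forall>a\<in>A. a \<le> c"
  then have "top \<le> c"
    using isLub_top by (intro isLub_le_isUb[of UNIV A]) (auto simp: isUb_def setle_def)
  then show "c = top" by (simp add: top_unique)
qed simp

text \<open>Join-primeness puts \<open>a\<close> below some member of \<open>S\<close>, and the
  antichain property makes them equal. So a subset of \<open>A\<close> is recovered from its
  join.\<close>

lemma le_fin_join_iff:
  assumes "a \<in> A" "S \<subseteq> A"
  shows "a \<le> fin_join S \<longleftrightarrow> a \<in> S"
proof -
  have "finite S" using assms finite finite_subset by blast
  then show ?thesis
    using join_irreducible_le_fin_join_iff[OF irreducible[OF assms(1)], of S] assms antichain
    by (auto simp: antichain_def)
qed

text \<open>Both sides have the same upper bounds \<open>c\<close>: by adjunction and
  join-primeness, each says that every element of \<open>A\<close> lies below \<open>p\<close> or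
  below \<open>c\<close>.\<close>

lemma brouwer_neg_eq_fin_join: "\<not>\<^sub>B p = fin_join {a \<in> A. \<not> a \<le> p}"
proof -
  have "\<not>\<^sub>B p \<le> c \<longleftrightarrow> fin_join {a \<in> A. \<not> a \<le> p} \<le> c" for c
  proof -
    have "\<not>\<^sub>B p \<le> c \<longleftrightarrow> sup p c = top"
      using brouwer_adjoint[of top p c] by (simp add: brouwer_neg_def top_unique)
    also have "\<dots> \<longleftrightarrow> (\<forall>a\<in>A. a \<le> p \<or> a \<le> c)"
      by (simp add: eq_top_iff join_irreducible_le_sup_iff irreducible)
    finally show ?thesis
      using finite by (auto simp: fin_join_le_iff)
  qed
  then show ?thesis by (blast intro: order_antisym)
qed

text \<open>Seen from \<open>A\<close>, negation acts as Boolean complement.\<close>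

lemma le_brouwer_neg_iff: "a \<in> A \<Longrightarrow> a \<le> \<not>\<^sub>B p \<longleftrightarrow> \<not> a \<le> p"
  by (simp add: brouwer_neg_eq_fin_join le_fin_join_iff)

lemma brouwer_neg_le_brouwer_neg_iff:
  "\<not>\<^sub>B q \<le> \<not>\<^sub>B p \<longleftrightarrow> {a \<in> A. \<not> a \<le> q} \<subseteq> {a \<in> A. \<not> a \<le> p}"
  using finite by (auto simp: brouwer_neg_eq_fin_join[of q] fin_join_le_iff le_brouwer_neg_iff)

end

lemma class_B_iff:
  "class_B m TYPE('a::brouwer_algebra) \<longleftrightarrow>
    (\<exists>A :: 'a set. join_irreducible_antichain A \<and> card A = m)"
  by (auto simp: class_B_def join_irreducible_antichain_def)

section \<open>Evaluation of the formulas\<close>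

lemma phi_eq_foldr:
  assumes "k > 1"
  shows "phi k = foldr Disj
      [Imp (Neg (Var i)) (Neg (Var j)). i \<leftarrow> [1..<k+1], j \<leftarrow> [1..<k+1], i \<noteq> j]
      (Neg (foldr Conj [Neg (Var i). i \<leftarrow> [1..<k]] (Neg (Var k))))"
  unfolding phi_def using assms by (intro if_not_P) simp

lemma form_eval_foldr_Disj_eq_bot:
  fixes v :: "nat \<Rightarrow> 'a::brouwer_algebra"
  assumes "\<exists>D \<in> insert C (set Ds). form_eval v D = bot"
  shows "form_eval v (foldr Disj Ds C) = bot"
  using assms
proof (induction Ds)
  case (Cons D Ds)
  then show ?case
    by (cases "form_eval v D = bot") auto
qed simp

text \<open>Meet-irreducibility of \<open>bot\<close> says that two nonzero elements have a nonzero
  meet; induction extends this to the whole fold.\<close>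

lemma form_eval_foldr_Disj_neq_bot:
  fixes v :: "nat \<Rightarrow> 'a::brouwer_algebra"
  assumes "meet_irreducible (bot :: 'a)"
    and "\<forall>D \<in> insert C (set Ds). form_eval v D \<noteq> bot"
  shows "form_eval v (foldr Disj Ds C) \<noteq> bot"
  using assms(2)
proof (induction Ds)
  case (Cons D Ds)
  then show ?case
    using assms(1) unfolding meet_irreducible_def by (metis foldr.simps(2) comp_apply
        form_eval.simps(2) insert_iff list.set_intros(1) list.set_intros(2))
qed simp

lemma join_irreducible_le_form_eval_foldr_Conj_iff:
  fixes v :: "nat \<Rightarrow> 'a::brouwer_algebra"
  assumes "join_irreducible a"
  shows "a \<le> form_eval v (foldr Conj Cs C) \<longleftrightarrow> (\<exists>D \<in> insert C (set Cs). a \<le> form_eval v D)"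
  by (induction Cs) (auto simp: join_irreducible_le_sup_iff[OF assms])

context join_irreducible_antichain
begin

text \<open>A negation is zero iff its argument is \<open>top\<close>. Here the argument is a join
  of negations, and it is \<open>top\<close> iff each \<open>a \<in> A\<close> lies below one of
  them.\<close>

lemma form_eval_last_disjunct_eq_bot_iff:
  assumes "k \<ge> 1"
  shows "form_eval v (Neg (foldr Conj [Neg (Var i). i \<leftarrow> [1..<k]] (Neg (Var k)))) = bot
    \<longleftrightarrow> A \<subseteq> (\<Union>i\<in>{1..k}. {a \<in> A. \<not> a \<le> v i})"
proof -
  \<comment> \<open>The conjunct with index \<open>k\<close> is the base of the fold, outside the
    list.\<close>
  have "insert k {1..<k} = {1..k}" using assms by auto
  then have "a \<le> form_eval v (foldr Conj [Neg (Var i). i \<leftarrow> [1..<k]] (Neg (Var k)))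
      \<longleftrightarrow> (\<exists>i\<in>{1..k}. \<not> a \<le> v i)" if "a \<in> A" for a
    using that by (auto simp: join_irreducible_le_form_eval_foldr_Conj_iff irreducible
        le_brouwer_neg_iff)
  then show ?thesis
    by (auto simp: brouwer_neg_eq_bot_iff eq_top_iff)
qed

text \<open>One zero disjunct makes the meet zero. The indices appear swapped because an implication
  is zero when its conclusion lies below its premise.\<close>

lemma form_eval_phi_eq_bot:
  assumes "k > 1"
    and "(\<exists>i\<in>{1..k}. \<exists>j\<in>{1..k}. i \<noteq> j \<and> {a \<in> A. \<not> a \<le> v j} \<subseteq> {a \<in> A. \<not> a \<le> v i})
      \<or> A \<subseteq> (\<Union>i\<in>{1..k}. {a \<in> A. \<not> a \<le> v i})"
  shows "form_eval v (phi k) = bot"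
  using assms(2)
proof
  assume "\<exists>i\<in>{1..k}. \<exists>j\<in>{1..k}. i \<noteq> j \<and> {a \<in> A. \<not> a \<le> v j} \<subseteq> {a \<in> A. \<not> a \<le> v i}"
  then obtain i j where ij: "i \<in> {1..k}" "j \<in> {1..k}" "i \<noteq> j"
    and "{a \<in> A. \<not> a \<le> v j} \<subseteq> {a \<in> A. \<not> a \<le> v i}"
    by blast
  then have bot: "form_eval v (Imp (Neg (Var i)) (Neg (Var j))) = bot"
    unfolding form_eval.simps brouwer_imp_eq_bot_iff brouwer_neg_le_brouwer_neg_iff by simp
  have "Imp (Neg (Var i)) (Neg (Var j)) \<in>
      set [Imp (Neg (Var i)) (Neg (Var j)). i \<leftarrow> [1..<k+1], j \<leftarrow> [1..<k+1], i \<noteq> j]"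
    using ij by auto
  with bot have "form_eval v (foldr Disj
      [Imp (Neg (Var i)) (Neg (Var j)). i \<leftarrow> [1..<k+1], j \<leftarrow> [1..<k+1], i \<noteq> j] C) = bot" for C
    by (blast intro: form_eval_foldr_Disj_eq_bot)
  then show ?thesis
    by (simp only: phi_eq_foldr[OF assms(1)])
next
  assume "A \<subseteq> (\<Union>i\<in>{1..k}. {a \<in> A. \<not> a \<le> v i})"
  then have "form_eval v (Neg (foldr Conj [Neg (Var i). i \<leftarrow> [1..<k]] (Neg (Var k)))) = bot"
    using assms(1) by (subst form_eval_last_disjunct_eq_bot_iff) auto
  then have "form_eval v (foldr Disj Ds
      (Neg (foldr Conj [Neg (Var i). i \<leftarrow> [1..<k]] (Neg (Var k))))) = bot" for Ds
    by (blast intro: form_eval_foldr_Disj_eq_bot)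
  then show ?thesis
    by (simp only: phi_eq_foldr[OF assms(1)])
qed

lemma form_eval_phi_neq_bot:
  assumes "meet_irreducible (bot :: 'a)" "k > 1"
    and incomparable: "\<And>i j. i \<in> {1..k} \<Longrightarrow> j \<in> {1..k} \<Longrightarrow> i \<noteq> j \<Longrightarrow>
      \<not> {a \<in> A. \<not> a \<le> v j} \<subseteq> {a \<in> A. \<not> a \<le> v i}"
    and no_cover: "\<not> A \<subseteq> (\<Union>i\<in>{1..k}. {a \<in> A. \<not> a \<le> v i})"
  shows "form_eval v (phi k) \<noteq> bot"
proof -
  let ?Ds = "[Imp (Neg (Var i)) (Neg (Var j)). i \<leftarrow> [1..<k+1], j \<leftarrow> [1..<k+1], i \<noteq> j]"
  let ?C = "Neg (foldr Conj [Neg (Var i). i \<leftarrow> [1..<k]] (Neg (Var k)))"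
  have "form_eval v D \<noteq> bot" if "D \<in> set ?Ds" for D
  proof -
    from that obtain i j where ij: "i \<in> {1..k}" "j \<in> {1..k}" "i \<noteq> j"
      and D: "D = Imp (Neg (Var i)) (Neg (Var j))"
      by (auto simp: less_Suc_eq_le split: if_splits)
    show ?thesis
      unfolding D form_eval.simps brouwer_imp_eq_bot_iff brouwer_neg_le_brouwer_neg_iff
      using ij by (rule incomparable)
  qed
  moreover have "form_eval v ?C \<noteq> bot"
    using assms(2) no_cover by (subst form_eval_last_disjunct_eq_bot_iff) auto
  ultimately have "form_eval v (foldr Disj ?Ds ?C) \<noteq> bot"
    by (intro form_eval_foldr_Disj_neq_bot assms(1)) blast
  then show ?thesis
    by (simp only: phi_eq_foldr[OF assms(2)] not_False_eq_True)
qed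

section \<open>Sperner families and \<open>phi k\<close> for \<open>k > 1\<close>\<close>

text \<open>If all disjuncts were nonzero, the \<open>k\<close> sets would form an antichain inside
  a proper subset of \<open>A\<close>, hence on fewer than \<open>n\<close> points, where Sperner's
  bound is below \<open>k\<close>.\<close>

lemma satisfies_phi:
  assumes "k > 1" "n choose (n div 2) = k" "card A \<le> n"
  shows "satisfies TYPE('a) (phi k)"
  unfolding satisfies_def
proof
  fix v :: "nat \<Rightarrow> 'a"
  define S where "S i = {a \<in> A. \<not> a \<le> v i}" for i
  \<comment> \<open>For \<open>n\<close> equal to 0 or 1 the central coefficient is 1, contradicting
    \<open>k > 1\<close>.\<close>
  have "n \<ge> 2"
    using assms by (cases "n = 0 \<or> n = 1") auto
  have cover: "A \<subseteq> (\<Union>i\<in>{1..k}. S i)"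
    if incomparable: "\<And>i j. i \<in> {1..k} \<Longrightarrow> j \<in> {1..k} \<Longrightarrow> S i \<subseteq> S j \<Longrightarrow> i = j"
  proof (rule ccontr)
    let ?U = "\<Union>i\<in>{1..k}. S i"
    assume "\<not> A \<subseteq> ?U"
    then have "?U \<subset> A" unfolding S_def by blast
    then have U: "finite ?U" "card ?U < n"
      using finite_subset[OF _ finite, of ?U] psubset_card_mono[OF finite, of ?U] assms(3)
      by (blast, linarith)
    \<comment> \<open>Incomparability across indices also makes the sets distinct, so the family
      really has \<open>k\<close> members.\<close>
    have "inj_on S {1..k}"
      by (rule inj_onI) (blast intro: incomparable)
    then have "k = card (S ` {1..k})"
      by (simp add: card_image)
    also have "\<dots> \<le> card ?U choose (card ?U div 2)"
    proof (rule sperner[OF U(1)])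
      show "Defs.antichain (S ` {1..k})"
        unfolding antichain_def using incomparable by fast
    qed blast
    also have "\<dots> < n choose (n div 2)"
      using U(2) \<open>n \<ge> 2\<close> by (rule central_binomial_strict_mono)
    finally show False using assms(2) by simp
  qed
  have "(\<exists>i\<in>{1..k}. \<exists>j\<in>{1..k}. i \<noteq> j \<and> S j \<subseteq> S i) \<or> A \<subseteq> (\<Union>i\<in>{1..k}. S i)"
  proof (rule disjCI)
    assume "\<not> A \<subseteq> (\<Union>i\<in>{1..k}. S i)"
    then obtain i j where "i \<in> {1..k}" "j \<in> {1..k}" "S i \<subseteq> S j" "i \<noteq> j"
      using cover by force
    then show "\<exists>i\<in>{1..k}. \<exists>j\<in>{1..k}. i \<noteq> j \<and> S j \<subseteq> S i"
      by (intro bexI[of _ j] bexI[of _ i]) auto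
  qed
  with assms(1) show "form_eval v (phi k) = bot"
    unfolding S_def by (rule form_eval_phi_eq_bot)
qed

text \<open>The middle layer of an \<open>n\<close>-element subset \<open>T\<close> of
  \<open>A\<close> supplies \<open>k\<close> incomparable sets, and their union misses
  \<open>A - T\<close>, which is nonempty.\<close>

lemma not_satisfies_phi:
  assumes "meet_irreducible (bot :: 'a)" "k > 1" "n choose (n div 2) = k" "card A > n"
  shows "\<not> satisfies TYPE('a) (phi k)"
proof -
  obtain T where T: "T \<subseteq> A" "card T = n" "finite T"
    using obtain_subset_with_card_n[of n A] assms(4) by (metis less_imp_le)
  let ?F = "{S. S \<subseteq> T \<and> card S = n div 2}"
  have "card ?F = k"
    using n_subsets[OF T(3)] T(2) assms(3) by simp
  moreover have "finite ?F" using T(3) by simp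
  ultimately obtain g where g: "bij_betw g {1..k} ?F"
    by (metis ex_bij_betw_nat_finite_1)
  have gT: "g i \<subseteq> T" "card (g i) = n div 2" if "i \<in> {1..k}" for i
    using bij_betwE[OF g] that by auto
  \<comment> \<open>Joining the elements outside \<open>g i\<close> makes \<open>g i\<close> exactly
    the set of elements of \<open>A\<close> not below \<open>v i\<close>.\<close>
  define v where "v i = fin_join (A - g i)" for i
  have S: "{a \<in> A. \<not> a \<le> v i} = g i" if "i \<in> {1..k}" for i
    using gT[OF that] T(1) by (auto simp: v_def le_fin_join_iff)
  have "form_eval v (phi k) \<noteq> bot"
  proof (rule form_eval_phi_neq_bot[OF assms(1,2)])
    fix i j assume ij: "i \<in> {1..k}" "j \<in> {1..k}" "i \<noteq> j"
    show "\<not> {a \<in> A. \<not> a \<le> v j} \<subseteq> {a \<in> A. \<not> a \<le> v i}"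
    proof
      assume "{a \<in> A. \<not> a \<le> v j} \<subseteq> {a \<in> A. \<not> a \<le> v i}"
      \<comment> \<open>Both sets have \<open>n div 2\<close> elements, so inclusion forces
        equality.\<close>
      then have "g j = g i"
        using gT[OF ij(1)] gT[OF ij(2)] T(3) S ij finite_subset
        by (intro card_subset_eq) auto
      then show False
        using g ij by (auto simp: bij_betw_def dest: inj_onD)
    qed
  next
    have "(\<Union>i\<in>{1..k}. {a \<in> A. \<not> a \<le> v i}) \<subseteq> T"
      using S gT(1) by blast
    moreover have "\<not> A \<subseteq> T"
      using T assms(4) card_mono by fastforce
    ultimately show "\<not> A \<subseteq> (\<Union>i\<in>{1..k}. {a \<in> A. \<not> a \<le> v i})"
      by blast
  qed
  then show ?thesis by (auto simp: satisfies_def)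
qed

section \<open>Weak excluded middle, the case \<open>k = 1\<close>\<close>

text \<open>A single \<open>a\<close> lies below \<open>v 1\<close> or below its negation, so one of
  these is \<open>top\<close>. If \<open>A\<close> is empty, every element is
  \<open>top\<close>.\<close>

lemma satisfies_phi_1:
  assumes "card A \<le> 1"
  shows "satisfies TYPE('a) (phi 1)"
  unfolding satisfies_def
proof
  fix v :: "nat \<Rightarrow> 'a"
  have "v 1 = top \<or> \<not>\<^sub>B v 1 = top"
  proof (cases "A = {}")
    case False
    then have "card A = 1"
      using assms finite by (simp add: le_Suc_eq)
    then obtain a where A: "A = {a}" by (rule card_1_singletonE)
    then have "a \<le> v 1 \<or> a \<le> \<not>\<^sub>B v 1"
      using le_brouwer_neg_iff[of a "v 1"] by blast
    then show ?thesis
      using eq_top_iff[of "v 1"] eq_top_iff[of "\<not>\<^sub>B v 1"] A by blast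
  next
    case True
    then show ?thesis using eq_top_iff[of "v 1"] by blast
  qed
  then have "\<not>\<^sub>B v 1 = bot \<or> \<not>\<^sub>B (\<not>\<^sub>B v 1) = bot"
    by (simp only: brouwer_neg_eq_bot_iff)
  then have "inf (\<not>\<^sub>B v 1) (\<not>\<^sub>B (\<not>\<^sub>B v 1)) = bot"
    by (metis inf_bot_left inf_bot_right)
  then show "form_eval v (phi 1) = bot"
    by (simp add: phi_def)
qed

text \<open>Take \<open>a \<in> A\<close> as the value of the variable: a second element of
  \<open>A\<close> is not below \<open>a\<close>, and \<open>a\<close> is not below its own
  negation, so neither is \<open>top\<close>.\<close>

lemma not_satisfies_phi_1:
  assumes "meet_irreducible (bot :: 'a)" "card A \<ge> 2"
  shows "\<not> satisfies TYPE('a) (phi 1)"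
proof -
  obtain a b where ab: "a \<in> A" "b \<in> A" "a \<noteq> b"
    using assms(2) card_le_Suc0_iff_eq[OF finite] by auto
  have "\<not> b \<le> a" "\<not> a \<le> \<not>\<^sub>B a"
    using ab antichain le_brouwer_neg_iff[of a a] unfolding antichain_def by auto
  then have "a \<noteq> top" "\<not>\<^sub>B a \<noteq> top"
    by (metis top_greatest)+
  then have "inf (\<not>\<^sub>B a) (\<not>\<^sub>B (\<not>\<^sub>B a)) \<noteq> bot"
    using assms(1) unfolding meet_irreducible_def by (metis brouwer_neg_eq_bot_iff)
  then have "form_eval (\<lambda>_. a) (phi 1) \<noteq> bot"
    by (simp add: phi_def)
  then show ?thesis unfolding satisfies_def by blast
qed

end

text \<open>The pair \<open>n = 0\<close>, \<open>m = 1\<close> is excluded from the second claim: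
  \<open>n = 0\<close> and \<open>n = 1\<close> both give \<open>k = 1\<close>, and
  \<open>phi 1\<close> is satisfied by every algebra in \<open>class_B 1\<close>.\<close>

theorem theorem3p8:
  fixes n k :: nat
  assumes "k \<ge> 1"
    and "n choose (n div 2) = k"
  shows "(\<forall>m. m \<le> n \<and> class_B m TYPE('a::brouwer_algebra) \<longrightarrow> satisfies TYPE('a) (phi k)) \<and>
         (\<forall>m. m > n \<and> (n, m) \<noteq> (0, 1) \<and> class_B_bot m TYPE('a) \<longrightarrow> \<not> satisfies TYPE('a) (phi k))"
proof (cases "k = 1")
  case True
  then have "n \<le> 1"
    using assms(2) central_binomial_strict_mono[of 1 n] by (cases "n \<ge> 2") auto
  show ?thesis
    unfolding True class_B_bot_def class_B_iff
  proof (intro conjI allI impI; elim conjE exE)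
    fix m and A :: "'a set"
    assume "m \<le> n" "join_irreducible_antichain A" "card A = m"
    with \<open>n \<le> 1\<close> show "satisfies TYPE('a) (phi 1)"
      by (intro join_irreducible_antichain.satisfies_phi_1) auto
  next
    fix m and A :: "'a set"
    assume A: "m > n" "(n, m) \<noteq> (0, 1)" "meet_irreducible (bot :: 'a)"
      "join_irreducible_antichain A" "card A = m"
    \<comment> \<open>For \<open>n = 0\<close> the condition \<open>m > n\<close> leaves
      \<open>m = 1\<close> open, and the excluded pair closes it.\<close>
    then have "card A \<ge> 2" by (cases n) auto
    with A show "\<not> satisfies TYPE('a) (phi 1)"
      by (intro join_irreducible_antichain.not_satisfies_phi_1)
  qed
next
  case False
  then have "k > 1" using assms(1) by simp
  show ?thesis
    unfolding class_B_bot_def class_B_iff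
  proof (intro conjI allI impI; elim conjE exE)
    fix m and A :: "'a set"
    assume "m \<le> n" "join_irreducible_antichain A" "card A = m"
    with \<open>k > 1\<close> assms(2) show "satisfies TYPE('a) (phi k)"
      by (intro join_irreducible_antichain.satisfies_phi) auto
  next
    fix m and A :: "'a set"
    assume "m > n" "meet_irreducible (bot :: 'a)" "join_irreducible_antichain A" "card A = m"
    with \<open>k > 1\<close> assms(2) show "\<not> satisfies TYPE('a) (phi k)"
      by (intro join_irreducible_antichain.not_satisfies_phi) auto
  qed
qed

end
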